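(* Let $p,K\ge 1$ be integers, let $\boldsymbol S\in\mathbb C^{p\times p}$ be a covariance matrix (Hermitian positive semidefinite), and let $\boldsymbol J_0,\ldots,\boldsymbol J_{K-1}$ be independent and identically distributed random vectors, each distributed as $\mathcal N_p^C\{\boldsymbol 0,\boldsymbol S\}$. Put $\hat{\boldsymbol S}=\frac1K\sum_{k=0}^{K-1}\boldsymbol J_k\boldsymbol J_k^H$ and $\hat{\boldsymbol T}=(\mathrm{tr}\{\hat{\boldsymbol S}\}/p)\boldsymbol I_p$. Then the quantity $$\rho_0=\frac{E\big\{\mathrm{tr}\{[\hat{\boldsymbol S}-\boldsymbol S][\hat{\boldsymbol S}-\hat{\boldsymbol T}]\}\big\}}{E\big\{\mathrm{tr}\{[\hat{\boldsymbol S}-\hat{\boldsymbol T}]^2\}\big\}}$$ can be written $$\rho_0=\frac{\mathrm{tr}^2\{\boldsymbol S\}-\frac1p\,\mathrm{tr}\{\boldsymbol S^2\}}{\left[1-\frac Kp\right]\mathrm{tr}^2\{\boldsymbol S\}+\left[K-\frac1p\right]\mathrm{tr}\{\boldsymbol S^2\}}.$$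
   Context: $\mathcal N_p^C\{\boldsymbol 0,\boldsymbol S\}$ denotes the zero-mean circularly-symmetric $p$-variate complex Gaussian distribution with covariance matrix $E\{\boldsymbol J\boldsymbol J^H\}=\boldsymbol S$ (and $E\{\boldsymbol J\boldsymbol J^T\}=\boldsymbol 0$). $^H$ is conjugate transpose, $\mathrm{tr}$ is the trace, $\mathrm{tr}^2\{\boldsymbol A\}=(\mathrm{tr}\{\boldsymbol A\})^2$, and $\boldsymbol I_p$ is the $p\times p$ identity matrix. The ratio $\rho_0$ is considered whenever its denominator is nonzero. *)

theory Defs
  imports "HOL-Probability.Probability"
begin

definition hermitian :: "complex ^ 'n ^ 'n \<Rightarrow> bool" where
  "hermitian A \<longleftrightarrow> (\<chi> i j. cnj (A $ j $ i)) = A"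

definition positive_semidefinite :: "complex ^ 'n ^ 'n \<Rightarrow> bool" where
  "positive_semidefinite A \<longleftrightarrow>
     hermitian A \<and> (\<forall>x. 0 \<le> Re (\<Sum>i\<in>UNIV. cnj (x $ i) * (A *v x) $ i))"

text \<open>The products \<open>x y\<^sup>H\<close> and \<open>x y\<^sup>T\<close> of column vectors.\<close>

definition outer_H :: "complex ^ 'n \<Rightarrow> complex ^ 'n \<Rightarrow> complex ^ 'n ^ 'n" where
  "outer_H x y = (\<chi> i j. x $ i * cnj (y $ j))"

definition outer_T :: "complex ^ 'n \<Rightarrow> complex ^ 'n \<Rightarrow> complex ^ 'n ^ 'n" where
  "outer_T x y = (\<chi> i j. x $ i * y $ j)"

text \<open>A real Gaussian random variable. The variance may be zero, in which case the variable is
  almost surely constant.\<close>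

definition gaussian_rv :: "'w measure \<Rightarrow> ('w \<Rightarrow> real) \<Rightarrow> bool" where
  "gaussian_rv M X \<longleftrightarrow> X \<in> borel_measurable M \<and>
     ((\<exists>\<mu>. AE \<omega> in M. X \<omega> = \<mu>) \<or>
      (\<exists>\<mu> \<sigma>. 0 < \<sigma> \<and> distributed M lborel X (\<lambda>x. ennreal (normal_density \<mu> \<sigma> x))))"

text \<open>The random vector \<open>X\<close> has the zero-mean circularly-symmetric complex Gaussian distribution
  with covariance matrix \<open>S\<close>, which may be singular. The inner product on \<^typ>\<open>complex ^ 'n\<close> is the
  real one, \<open>a \<bullet> x = (\<Sum>i. Re (a $ i) * Re (x $ i) + Im (a $ i) * Im (x $ i))\<close>, so the second
  conjunct says that the real and imaginary parts of all components of \<open>X\<close> are jointly Gaussian.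
  The integrals are vector- and matrix-valued.\<close>

definition complex_gaussian ::
    "'w measure \<Rightarrow> complex ^ 'n ^ 'n \<Rightarrow> ('w \<Rightarrow> complex ^ 'n) \<Rightarrow> bool" where
  "complex_gaussian M S X \<longleftrightarrow>
     X \<in> borel_measurable M \<and>
     (\<forall>a. gaussian_rv M (\<lambda>\<omega>. a \<bullet> X \<omega>)) \<and>
     (\<integral>\<omega>. X \<omega> \<partial>M) = 0 \<and>
     (\<integral>\<omega>. outer_H (X \<omega>) (X \<omega>) \<partial>M) = S \<and>
     (\<integral>\<omega>. outer_T (X \<omega>) (X \<omega>) \<partial>M) = 0"

definition sample_cov :: "nat \<Rightarrow> (nat \<Rightarrow> 'w \<Rightarrow> complex ^ 'n) \<Rightarrow> 'w \<Rightarrow> complex ^ 'n ^ 'n" where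
  "sample_cov K J \<omega> = (1 / real K) *\<^sub>R (\<Sum>k<K. outer_H (J k \<omega>) (J k \<omega>))"

text \<open>Note that \<open>mat c\<close> is \<open>c\<close> times the identity matrix.\<close>

definition target :: "nat \<Rightarrow> (nat \<Rightarrow> 'w \<Rightarrow> complex ^ 'n) \<Rightarrow> 'w \<Rightarrow> complex ^ 'n ^ 'n" where
  "target K J \<omega> = mat (trace (sample_cov K J \<omega>) / of_nat CARD('n))"

definition rho0_num ::
    "'w measure \<Rightarrow> complex ^ 'n ^ 'n \<Rightarrow> nat \<Rightarrow> (nat \<Rightarrow> 'w \<Rightarrow> complex ^ 'n) \<Rightarrow> complex" where
  "rho0_num M S K J =
     (\<integral>\<omega>. trace ((sample_cov K J \<omega> - S) ** (sample_cov K J \<omega> - target K J \<omega>)) \<partial>M)"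

definition rho0_den :: "'w measure \<Rightarrow> nat \<Rightarrow> (nat \<Rightarrow> 'w \<Rightarrow> complex ^ 'n) \<Rightarrow> complex" where
  "rho0_den M K J =
     (\<integral>\<omega>. trace ((sample_cov K J \<omega> - target K J \<omega>) ** (sample_cov K J \<omega> - target K J \<omega>)) \<partial>M)"

definition rho0 ::
    "'w measure \<Rightarrow> complex ^ 'n ^ 'n \<Rightarrow> nat \<Rightarrow> (nat \<Rightarrow> 'w \<Rightarrow> complex ^ 'n) \<Rightarrow> complex" where
  "rho0 M S K J = rho0_num M S K J / rho0_den M K J"

end

theory Submission
  imports Defs
begin

text \<open>Write \<open>R\<close> for the sample covariance. Both integrands of \<open>\<rho>\<^sub>0\<close> are
  linear in \<open>tr (R\<^sup>2)\<close>, \<open>(tr R)\<^sup>2\<close> and the entries of \<open>R\<close>. Expanding the first two into double sums over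
  the samples, independence settles the terms with \<open>k \<noteq> l\<close>. For \<open>k = l\<close> both terms equal
  \<open>(tr (J J\<^sup>H))\<^sup>2\<close>, since \<open>J J\<^sup>H\<close> has rank one; its expectation \<open>(tr S)\<^sup>2 + tr (S\<^sup>2)\<close> follows from
  the real fourth moments \<open>E (x\<^sup>2 y\<^sup>2) = E (x\<^sup>2) E (y\<^sup>2) + 2 (E (x y))\<^sup>2\<close>, which polarization reduces to
  the fourth moment of a single real Gaussian variable.\<close>

section \<open>Moments of centered real Gaussian variables, and products of independent ones\<close>

context prob_space
begin

text \<open>The Bochner integral of a non-integrable function is 0 by convention, so linearity of
  expectations can be used only once integrability is known.\<close>

lemma gaussian_rv_integrable:
  assumes "gaussian_rv M X"
  shows "integrable M X"
proof -
  have [measurable]: "X \<in> borel_measurable M" using assms by (simp add: gaussian_rv_def)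
  consider \<mu> where "AE \<omega> in M. X \<omega> = \<mu>"
    | \<mu> \<sigma> where "0 < \<sigma>" "distributed M lborel X (\<lambda>x. ennreal (normal_density \<mu> \<sigma> x))"
    using assms unfolding gaussian_rv_def by blast
  then show ?thesis
  proof cases
    case 1
    then have "integrable M X \<longleftrightarrow> integrable M (\<lambda>_. \<mu>)"
      by (intro integrable_cong_AE) auto
    then show ?thesis by simp
  next
    case 2
    then show ?thesis
      using distributed_integrable[OF 2(2), of "\<lambda>x. x"] integrable_normal_moment_nz_1[OF 2(1)]
      by simp
  qed
qed

text \<open>A constant with mean zero is almost surely 0, and then all these moments vanish;
  otherwise the even normal moments give variance \<open>\<sigma>\<^sup>2\<close> and fourth moment
  \<open>3 * (\<sigma>\<^sup>2)\<^sup>2\<close>. Stated through the variance, one formula covers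
  both cases, so singular covariance matrices need no separate treatment.\<close>

lemma centered_gaussian_rv_moments:
  assumes "gaussian_rv M X" "expectation X = 0"
  shows "integrable M (\<lambda>\<omega>. X \<omega> ^ 2)"
    and "has_bochner_integral M (\<lambda>\<omega>. X \<omega> ^ 4) (3 * (expectation (\<lambda>\<omega>. X \<omega> ^ 2))\<^sup>2)"
proof -
  have [measurable]: "X \<in> borel_measurable M" using assms by (simp add: gaussian_rv_def)
  consider \<mu> where "AE \<omega> in M. X \<omega> = \<mu>"
    | \<mu> \<sigma> where "0 < \<sigma>" "distributed M lborel X (\<lambda>x. ennreal (normal_density \<mu> \<sigma> x))"
    using assms unfolding gaussian_rv_def by blast
  then have "integrable M (\<lambda>\<omega>. X \<omega> ^ 2) \<and>
    has_bochner_integral M (\<lambda>\<omega>. X \<omega> ^ 4) (3 * (expectation (\<lambda>\<omega>. X \<omega> ^ 2))\<^sup>2)"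
  proof cases
    case 1
    have "expectation X = expectation (\<lambda>_. \<mu>)"
      using 1 by (intro integral_cong_AE) auto
    then have "\<mu> = 0" using assms(2) by (simp add: prob_space)
    then have X0: "AE \<omega> in M. X \<omega> = 0" using 1 by simp
    then have "has_bochner_integral M (\<lambda>\<omega>. X \<omega> ^ n) 0" if "0 < n" for n
      by (subst has_bochner_integral_cong_AE[where g="\<lambda>_. 0"]) (use that in auto)
    from this[of 2] this[of 4] show ?thesis
      by (auto simp: has_bochner_integral_iff)
  next
    case 2
    have "expectation X = \<mu>"
      using distributed_integral[OF 2(2), of "\<lambda>x. x"] integral_normal_moment_nz_1[OF 2(1), of \<mu>]
      by simp
    then have "\<mu> = 0" using assms(2) by simp
    note d = 2(2)[unfolded this]
    have *: "has_bochner_integral M (\<lambda>\<omega>. X \<omega> ^ (2 * k)) (fact (2 * k) / ((2 / \<sigma>\<^sup>2) ^ k * fact k))" for k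
      using normal_moment_even[OF 2(1), of 0 k]
        distributed_integral[OF d, of "\<lambda>x. x ^ (2 * k)"] distributed_integrable[OF d, of "\<lambda>x. x ^ (2 * k)"]
      by (simp add: has_bochner_integral_iff)
    have "has_bochner_integral M (\<lambda>\<omega>. X \<omega> ^ 2) (\<sigma>\<^sup>2)"
      using *[of 1] 2(1) by simp
    moreover have "has_bochner_integral M (\<lambda>\<omega>. X \<omega> ^ 4) (3 * (\<sigma>\<^sup>2)\<^sup>2)"
      using *[of 2] 2(1) by (simp add: fact_numeral field_simps)
    ultimately show ?thesis
      by (auto simp: has_bochner_integral_iff)
  qed
  then show "integrable M (\<lambda>\<omega>. X \<omega> ^ 2)"
    "has_bochner_integral M (\<lambda>\<omega>. X \<omega> ^ 4) (3 * (expectation (\<lambda>\<omega>. X \<omega> ^ 2))\<^sup>2)" by auto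
qed

text \<open>This is a case of the Isserlis (Wick) formula. Since \<open>a + b\<close> and
  \<open>a - b\<close> are again admissible directions, one-dimensional moments suffice and no joint
  density is needed.\<close>

lemma gaussian_fourth_moment:
  fixes X :: "'a \<Rightarrow> 'b::euclidean_space"
  assumes G: "\<And>a. gaussian_rv M (\<lambda>\<omega>. a \<bullet> X \<omega>)" and E0: "\<And>a. expectation (\<lambda>\<omega>. a \<bullet> X \<omega>) = 0"
  shows "integrable M (\<lambda>\<omega>. (a \<bullet> X \<omega>) * (b \<bullet> X \<omega>))"
    and "has_bochner_integral M (\<lambda>\<omega>. (a \<bullet> X \<omega>)\<^sup>2 * (b \<bullet> X \<omega>)\<^sup>2)
      (expectation (\<lambda>\<omega>. (a \<bullet> X \<omega>)\<^sup>2) * expectation (\<lambda>\<omega>. (b \<bullet> X \<omega>)\<^sup>2)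
        + 2 * (expectation (\<lambda>\<omega>. (a \<bullet> X \<omega>) * (b \<bullet> X \<omega>)))\<^sup>2)"
proof -
  note moments = centered_gaussian_rv_moments[OF G E0]
  let ?v = "\<lambda>a. expectation (\<lambda>\<omega>. (a \<bullet> X \<omega>)\<^sup>2)"
  let ?c = "expectation (\<lambda>\<omega>. (a \<bullet> X \<omega>) * (b \<bullet> X \<omega>))"
  have "(\<lambda>\<omega>. (a \<bullet> X \<omega>) * (b \<bullet> X \<omega>)) =
      (\<lambda>\<omega>. (((a + b) \<bullet> X \<omega>)\<^sup>2 - (a \<bullet> X \<omega>)\<^sup>2 - (b \<bullet> X \<omega>)\<^sup>2) / 2)"
    by (simp add: inner_add_left power2_eq_square field_simps)
  then show int: "integrable M (\<lambda>\<omega>. (a \<bullet> X \<omega>) * (b \<bullet> X \<omega>))"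
    using moments(1) by simp
  have "?v (a + b) = expectation (\<lambda>\<omega>. (a \<bullet> X \<omega>)\<^sup>2 + (b \<bullet> X \<omega>)\<^sup>2 + 2 * ((a \<bullet> X \<omega>) * (b \<bullet> X \<omega>)))"
    by (simp add: inner_add_left power2_eq_square algebra_simps)
  also have "\<dots> = ?v a + ?v b + 2 * ?c" using int moments(1) by simp
  finally have plus: "?v (a + b) = ?v a + ?v b + 2 * ?c" .
  have "?v (a - b) = expectation (\<lambda>\<omega>. (a \<bullet> X \<omega>)\<^sup>2 + (b \<bullet> X \<omega>)\<^sup>2 - 2 * ((a \<bullet> X \<omega>) * (b \<bullet> X \<omega>)))"
    by (simp add: inner_diff_left power2_eq_square algebra_simps)
  also have "\<dots> = ?v a + ?v b - 2 * ?c" using int moments(1) by simp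
  finally have minus: "?v (a - b) = ?v a + ?v b - 2 * ?c" .
  \<comment> \<open>Polarization: 12 x^2 y^2 = (x + y)^4 + (x - y)^4 - 2 x^4 - 2 y^4. Replacing each
    fourth power by three times the squared variance gives the same combination on the side of the
    expectations.\<close>
  have "(\<lambda>\<omega>. (a \<bullet> X \<omega>)\<^sup>2 * (b \<bullet> X \<omega>)\<^sup>2) =
      (\<lambda>\<omega>. (((a + b) \<bullet> X \<omega>) ^ 4 + ((a - b) \<bullet> X \<omega>) ^ 4 - 2 * (a \<bullet> X \<omega>) ^ 4 - 2 * (b \<bullet> X \<omega>) ^ 4) / 12)"
    unfolding inner_add_left inner_diff_left by (rule ext) algebra
  moreover have "?v a * ?v b + 2 * ?c\<^sup>2 =
      (3 * (?v (a + b))\<^sup>2 + 3 * (?v (a - b))\<^sup>2 - 2 * (3 * (?v a)\<^sup>2) - 2 * (3 * (?v b)\<^sup>2)) / 12"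
    unfolding plus minus by algebra
  ultimately show "has_bochner_integral M (\<lambda>\<omega>. (a \<bullet> X \<omega>)\<^sup>2 * (b \<bullet> X \<omega>)\<^sup>2) (?v a * ?v b + 2 * ?c\<^sup>2)"
    by (simp only:) (intro has_bochner_integral_divide_zero has_bochner_integral_diff
        has_bochner_integral_add has_bochner_integral_mult_right moments(2))
qed

lemma has_bochner_integral_mult_indep_vars:
  fixes f g :: "'b \<Rightarrow> 'c::{real_normed_field, banach, second_countable_topology}"
  assumes "indep_vars (\<lambda>_. N) X I" "i \<in> I" "j \<in> I" "i \<noteq> j"
    and [measurable]: "f \<in> borel_measurable N" "g \<in> borel_measurable N"
    and "has_bochner_integral M (\<lambda>\<omega>. f (X i \<omega>)) x" "has_bochner_integral M (\<lambda>\<omega>. g (X j \<omega>)) y"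
  shows "has_bochner_integral M (\<lambda>\<omega>. f (X i \<omega>) * g (X j \<omega>)) (x * y)"
proof -
  \<comment> \<open>Both factors are put into one family indexed by \<open>{i, j}\<close>, so that
    the product rule for independent families applies; \<open>i \<noteq> j\<close> makes
    \<open>?h j\<close> equal to \<open>g\<close>.\<close>
  let ?h = "\<lambda>k. if k = i then f else g"
  have "indep_vars (\<lambda>_. borel) (\<lambda>k \<omega>. ?h k (X k \<omega>)) {i, j}"
    by (rule indep_vars_compose2[OF indep_vars_subset[OF assms(1)]]) (use assms in auto)
  moreover have "integrable M (\<lambda>\<omega>. ?h k (X k \<omega>))" if "k \<in> {i, j}" for k
    using that assms by (auto simp: has_bochner_integral_iff)
  ultimately show ?thesis
    using indep_vars_lebesgue_integral[of "{i, j}" "\<lambda>k \<omega>. ?h k (X k \<omega>)"]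
      indep_vars_integrable[of "{i, j}" "\<lambda>k \<omega>. ?h k (X k \<omega>)"] assms
    by (auto simp: has_bochner_integral_iff)
qed

end

section \<open>Componentwise integration and trace identities\<close>

text \<open>A vector is the finite sum of its components embedded along the axes, and each embedding
  is bounded linear.\<close>

lemma integrable_vec:
  fixes f :: "'a \<Rightarrow> 'b::euclidean_space ^ 'n"
  assumes "\<And>i. integrable M (\<lambda>x. f x $ i)"
  shows "integrable M f"
proof -
  have "bounded_linear (axis i :: 'b \<Rightarrow> 'b ^ 'n)" for i :: 'n
    by (simp add: linear_conv_bounded_linear[symmetric] linear_iff vec_eq_iff axis_def)
  then have "integrable M (\<lambda>x. \<Sum>i\<in>UNIV. axis i (f x $ i))"
    by (intro Bochner_Integration.integrable_sum) (rule integrable_bounded_linear[OF _ assms])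
  also have "(\<lambda>x. \<Sum>i\<in>UNIV. axis i (f x $ i)) = f"
    by (simp add: fun_eq_iff vec_eq_iff axis_def)
  finally show ?thesis .
qed

lemma integral_vec_nth:
  fixes f :: "'a \<Rightarrow> 'b::euclidean_space ^ 'n"
  assumes "\<And>i. integrable M (\<lambda>x. f x $ i)"
  shows "integral\<^sup>L M f $ i = (\<integral>x. f x $ i \<partial>M)"
  using integral_bounded_linear[OF bounded_linear_vec_nth integrable_vec[OF assms], of i] by simp

lemma has_bochner_integral_Complex:
  assumes "has_bochner_integral M f x" "has_bochner_integral M g y"
  shows "has_bochner_integral M (\<lambda>\<omega>. Complex (f \<omega>) (g \<omega>)) (Complex x y)"
  unfolding Complex_eq
  by (intro has_bochner_integral_add has_bochner_integral_mult_right has_bochner_integral_of_real assms)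

lemma trace_matrix_mult: "trace (A ** B) = (\<Sum>i\<in>UNIV. \<Sum>j\<in>UNIV. A $ i $ j * B $ j $ i)"
  by (simp add: trace_def matrix_matrix_mult_def)

lemma trace_mult_diff_left:
  fixes A B C :: "complex ^ 'n ^ 'n"
  shows "trace ((A - B) ** C) = trace (A ** C) - trace (B ** C)"
  by (simp add: trace_matrix_mult left_diff_distrib sum_subtractf)

lemma trace_mult_diff_right:
  fixes A B C :: "complex ^ 'n ^ 'n"
  shows "trace (A ** (B - C)) = trace (A ** B) - trace (A ** C)"
  by (simp add: trace_matrix_mult right_diff_distrib sum_subtractf)

lemma trace_mult_mat_right: "trace (A ** mat c) = c * trace (A :: complex ^ 'n ^ 'n)"
  unfolding trace_matrix_mult unfolding trace_def
  by (simp add: mat_def if_distrib mult.commute sum_distrib_left cong: if_cong)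

lemma trace_mat: "trace (mat c :: complex ^ 'n ^ 'n) = of_nat CARD('n) * c"
  by (simp add: trace_def mat_def)

text \<open>The scalar matrix \<open>T\<close> has the same trace as \<open>A\<close>, and both
  \<open>trace (A ** T)\<close> and \<open>trace (T ** T)\<close> equal the squared trace of
  \<open>A\<close> divided by the dimension. Hence the quadratic terms in \<open>T\<close>
  collapse.\<close>

lemma trace_mult_scaled_target:
  fixes A B :: "complex ^ 'n ^ 'n"
  defines "T \<equiv> mat (trace A / of_nat CARD('n))"
  shows "trace ((A - B) ** (A - T)) =
      trace (A ** A) - (trace A)\<^sup>2 / of_nat CARD('n) - trace (B ** A) + trace A / of_nat CARD('n) * trace B"
    and "trace ((A - T) ** (A - T)) = trace (A ** A) - (trace A)\<^sup>2 / of_nat CARD('n)"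
  unfolding trace_mult_diff_left trace_mult_diff_right T_def trace_mul_sym[of "mat _" A]
    trace_mult_mat_right trace_sub trace_mat
  by (simp_all add: power2_eq_square algebra_simps diff_divide_distrib)

text \<open>The square of the rank-one matrix \<open>outer_H x x\<close> is its trace times
  itself.\<close>

lemma trace_outer_H_sq: "trace (outer_H x x ** outer_H x x) = (trace (outer_H x x))\<^sup>2"
  unfolding trace_matrix_mult by (simp add: trace_def outer_H_def power2_eq_square sum_product mult_ac)

lemma borel_measurable_outer_H_nth: "(\<lambda>x. outer_H x x $ i $ j) \<in> borel_measurable borel"
  unfolding outer_H_def by (auto intro!: borel_measurable_continuous_onI continuous_intros)

lemma sum_sum_diagonal:
  fixes a b :: complex
  shows "(\<Sum>k<K. \<Sum>l<K. a + (if k = l then b else 0)) = of_nat K * of_nat K * a + of_nat K * b"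
  by (simp add: sum.distrib algebra_simps)

lemma sample_cov_nth:
  "sample_cov K J \<omega> $ i $ j = (\<Sum>k<K. outer_H (J k \<omega>) (J k \<omega>) $ i $ j) / of_nat K"
  unfolding sample_cov_def by simp (simp add: scaleR_conv_of_real)

lemma trace_sample_cov:
  "trace (sample_cov K J \<omega>) = (\<Sum>k<K. trace (outer_H (J k \<omega>) (J k \<omega>))) / of_nat K"
  by (simp add: trace_def sample_cov_nth sum_divide_distrib[symmetric] sum.swap[of _ "{..<K}" UNIV])

section \<open>Moments of circular Gaussian vectors and of their sample covariance\<close>

context prob_space
begin

text \<open>The covariances of the real coordinates are determined by \<open>S\<close> together with
  circularity. The real fourth-moment formula, summed over all pairs of coordinates, therefore
  becomes an expression in the entries of \<open>S\<close>.\<close>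

lemma complex_gaussian_outer_H:
  fixes X :: "'a \<Rightarrow> complex ^ 'n"
  assumes X: "complex_gaussian M S X"
  shows complex_gaussian_second_moment:
      "has_bochner_integral M (\<lambda>\<omega>. outer_H (X \<omega>) (X \<omega>) $ i $ j) (S $ i $ j)"
    and complex_gaussian_fourth_moment:
      "has_bochner_integral M (\<lambda>\<omega>. (trace (outer_H (X \<omega>) (X \<omega>)))\<^sup>2) ((trace S)\<^sup>2 + trace (S ** S))"
proof -
  have G: "gaussian_rv M (\<lambda>\<omega>. a \<bullet> X \<omega>)" for a
    using X by (simp add: complex_gaussian_def)
  have components: "X \<omega> $ i = Complex (axis i 1 \<bullet> X \<omega>) (axis i \<i> \<bullet> X \<omega>)" for \<omega> i
    by (simp add: inner_axis' complex_eq_iff inner_complex_def)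
  have "integrable M X"
  proof (rule integrable_vec)
    show "integrable M (\<lambda>\<omega>. X \<omega> $ i)" for i
      unfolding components Complex_eq
      by (intro Bochner_Integration.integrable_add integrable_mult_right integrable_of_real
          gaussian_rv_integrable[OF G])
  qed
  \<comment> \<open>Integrability of \<open>X\<close> lets the inner product pass through the
    vector-valued integral, so every real projection inherits the zero mean.\<close>
  then have "expectation (\<lambda>\<omega>. a \<bullet> X \<omega>) = 0" for a
    using X by (simp add: complex_gaussian_def)
  note moments = gaussian_fourth_moment[of X, OF G this]
  \<comment> \<open>The values 1 and \<i> of \<open>u\<close> and \<open>v\<close> select real and
    imaginary parts, so \<open>c\<close> lists the covariances of the real coordinates.\<close>
  define c where "c i u j v = expectation (\<lambda>\<omega>. (axis i u \<bullet> X \<omega>) * (axis j v \<bullet> X \<omega>))" for i j u v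
  have c: "has_bochner_integral M (\<lambda>\<omega>. (axis i u \<bullet> X \<omega>) * (axis j v \<bullet> X \<omega>)) (c i u j v)" for i j u v
    using moments(1) by (simp add: has_bochner_integral_iff c_def)
  have c_sym: "c i u j v = c j v i u" for i j u v
    by (simp add: c_def mult.commute)
  have H_eq: "outer_H (X \<omega>) (X \<omega>) $ i $ j = Complex
      ((axis i 1 \<bullet> X \<omega>) * (axis j 1 \<bullet> X \<omega>) + (axis i \<i> \<bullet> X \<omega>) * (axis j \<i> \<bullet> X \<omega>))
      ((axis i \<i> \<bullet> X \<omega>) * (axis j 1 \<bullet> X \<omega>) - (axis i 1 \<bullet> X \<omega>) * (axis j \<i> \<bullet> X \<omega>))" for \<omega> i j
    by (simp add: outer_H_def components complex_eq_iff)
  have T_eq: "outer_T (X \<omega>) (X \<omega>) $ i $ j = Complex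
      ((axis i 1 \<bullet> X \<omega>) * (axis j 1 \<bullet> X \<omega>) - (axis i \<i> \<bullet> X \<omega>) * (axis j \<i> \<bullet> X \<omega>))
      ((axis i \<i> \<bullet> X \<omega>) * (axis j 1 \<bullet> X \<omega>) + (axis i 1 \<bullet> X \<omega>) * (axis j \<i> \<bullet> X \<omega>))" for \<omega> i j
    by (simp add: outer_T_def components complex_eq_iff)
  have H: "has_bochner_integral M (\<lambda>\<omega>. outer_H (X \<omega>) (X \<omega>) $ i $ j)
      (Complex (c i 1 j 1 + c i \<i> j \<i>) (c i \<i> j 1 - c i 1 j \<i>))" for i j
    unfolding H_eq by (intro has_bochner_integral_Complex has_bochner_integral_add has_bochner_integral_diff c)
  have T: "has_bochner_integral M (\<lambda>\<omega>. outer_T (X \<omega>) (X \<omega>) $ i $ j)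
      (Complex (c i 1 j 1 - c i \<i> j \<i>) (c i \<i> j 1 + c i 1 j \<i>))" for i j
    unfolding T_eq by (intro has_bochner_integral_Complex has_bochner_integral_add has_bochner_integral_diff c)
  \<comment> \<open>Componentwise integration is applied twice, to the rows and then to their
    entries.\<close>
  have entry: "(\<integral>\<omega>. F \<omega> \<partial>M) $ i $ j = z i j"
    if "\<And>i j. has_bochner_integral M (\<lambda>\<omega>. F \<omega> $ i $ j) (z i j)"
    for F :: "'a \<Rightarrow> complex ^ 'n ^ 'n" and z i j
    using that by (simp add: integral_vec_nth integrable_vec has_bochner_integral_iff)
  have S: "S $ i $ j = Complex (c i 1 j 1 + c i \<i> j \<i>) (c i \<i> j 1 - c i 1 j \<i>)" for i j
    using X entry[OF H] by (simp add: complex_gaussian_def)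
  then show "has_bochner_integral M (\<lambda>\<omega>. outer_H (X \<omega>) (X \<omega>) $ i $ j) (S $ i $ j)"
    using H by simp
  have "Complex (c i 1 j 1 - c i \<i> j \<i>) (c i \<i> j 1 + c i 1 j \<i>) = 0" for i j
    using X entry[OF T, of i j] by (simp add: complex_gaussian_def)
  \<comment> \<open>The vanishing mean of \<open>outer_T\<close> equates real-real with
    imaginary-imaginary covariances and makes the mixed ones antisymmetric in \<open>i\<close> and
    \<open>j\<close>. In particular the two parts of one component are uncorrelated.\<close>
  then have circular: "c i \<i> j \<i> = c i 1 j 1" "c i \<i> j 1 = - c i 1 j \<i>" for i j
    by (simp_all add: complex_eq_iff eq_neg_iff_add_eq_0)
  have antisym: "c j 1 i \<i> = - c i 1 j \<i>" for i j
    using circular(2)[of i j] c_sym[of i \<i> j 1] by simp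
  have diag: "c i 1 i \<i> = 0" for i
    using antisym[of i i] by simp
  \<comment> \<open>The trace is the squared norm, a sum of squares of real coordinates. Its square
    is thus a real sum of exactly the products covered by
    \<open>gaussian_fourth_moment\<close>.\<close>
  define Q where "Q \<omega> = (\<Sum>i\<in>UNIV. \<Sum>j\<in>UNIV. \<Sum>u\<in>{1,\<i>}. \<Sum>v\<in>{1,\<i>}.
      (axis i u \<bullet> X \<omega>)\<^sup>2 * (axis j v \<bullet> X \<omega>)\<^sup>2)" for \<omega>
  have trace_sq: "(trace (outer_H (X \<omega>) (X \<omega>)))\<^sup>2 = complex_of_real (Q \<omega>)" for \<omega>
  proof -
    have "trace (outer_H (X \<omega>) (X \<omega>)) = of_real (\<Sum>i\<in>UNIV. \<Sum>u\<in>{1,\<i>}. (axis i u \<bullet> X \<omega>)\<^sup>2)"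
      by (simp add: trace_def H_eq complex_eq_iff power2_eq_square complex_i_not_one[symmetric])
    moreover have "(\<Sum>i\<in>UNIV. \<Sum>u\<in>{1,\<i>}. (axis i u \<bullet> X \<omega>)\<^sup>2)\<^sup>2 = Q \<omega>"
      unfolding Q_def power2_eq_square[of "sum _ _"] sum_product ..
    ultimately show ?thesis by (simp only: of_real_power[symmetric])
  qed
  have "has_bochner_integral M Q (\<Sum>i\<in>UNIV. \<Sum>j\<in>UNIV. \<Sum>u\<in>{1,\<i>}. \<Sum>v\<in>{1,\<i>}.
      c i u i u * c j v j v + 2 * (c i u j v)\<^sup>2)"
    unfolding Q_def using moments(2)
    by (intro has_bochner_integral_sum) (simp add: c_def power2_eq_square)
  then have "has_bochner_integral M (\<lambda>\<omega>. complex_of_real (Q \<omega>)) (of_real (\<Sum>i\<in>UNIV. \<Sum>j\<in>UNIV.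
      \<Sum>u\<in>{1,\<i>}. \<Sum>v\<in>{1,\<i>}. c i u i u * c j v j v + 2 * (c i u j v)\<^sup>2))"
    by (rule has_bochner_integral_of_real)
  also have "of_real (\<Sum>i\<in>UNIV. \<Sum>j\<in>UNIV. \<Sum>u\<in>{1,\<i>}. \<Sum>v\<in>{1,\<i>}. c i u i u * c j v j v + 2 * (c i u j v)\<^sup>2)
      = (\<Sum>i\<in>UNIV. \<Sum>j\<in>UNIV. S $ i $ i * S $ j $ j + S $ i $ j * S $ j $ i)"
    unfolding of_real_sum
  proof (intro sum.cong refl)
    \<comment> \<open>The products of variances add up to \<open>S $ i $ i * S $ j $ j\<close>. By
      circularity the four squared covariances agree in pairs, and their doubled sum is
      \<open>4 * ((c i 1 j 1)\<^sup>2 + (c i 1 j \<i>)\<^sup>2)\<close>, the squared modulus of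
      \<open>S $ i $ j\<close>, which is \<open>S $ i $ j * S $ j $ i\<close>.\<close>
    fix i j
    show "(\<Sum>u\<in>{1,\<i>}. \<Sum>v\<in>{1,\<i>}. complex_of_real (c i u i u * c j v j v + 2 * (c i u j v)\<^sup>2))
        = S $ i $ i * S $ j $ j + S $ i $ j * S $ j $ i"
      using c_sym[of j 1 i 1] antisym[of j i]
      by (simp add: S complex_eq_iff circular diag complex_i_not_one[symmetric] power2_eq_square algebra_simps)
  qed
  also have "\<dots> = (trace S)\<^sup>2 + trace (S ** S)"
    by (simp add: trace_matrix_mult sum.distrib) (simp add: trace_def power2_eq_square sum_product)
  finally show "has_bochner_integral M (\<lambda>\<omega>. (trace (outer_H (X \<omega>) (X \<omega>)))\<^sup>2) ((trace S)\<^sup>2 + trace (S ** S))"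
    by (simp only: trace_sq)
qed

text \<open>Among the K^2 pairs of samples, every pair contributes the value expected under
  independence, and the K diagonal pairs add a correction. After division by K^2 the correction
  survives with the factor 1/K.\<close>

lemma sample_cov_moments:
  fixes J :: "nat \<Rightarrow> 'a \<Rightarrow> complex ^ 'n"
  assumes K: "K \<ge> 1"
    and indep: "indep_vars (\<lambda>_. borel) J {..<K}"
    and J: "\<And>k. k < K \<Longrightarrow> complex_gaussian M S (J k)"
  shows has_bochner_integral_sample_cov:
      "has_bochner_integral M (\<lambda>\<omega>. sample_cov K J \<omega> $ i $ j) (S $ i $ j)"
    and has_bochner_integral_trace_sample_cov_sq:
      "has_bochner_integral M (\<lambda>\<omega>. (trace (sample_cov K J \<omega>))\<^sup>2)
        ((trace S)\<^sup>2 + trace (S ** S) / of_nat K)"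
    and has_bochner_integral_trace_sample_cov_mult:
      "has_bochner_integral M (\<lambda>\<omega>. trace (sample_cov K J \<omega> ** sample_cov K J \<omega>))
        (trace (S ** S) + (trace S)\<^sup>2 / of_nat K)"
proof -
  let ?A = "\<lambda>k \<omega>. outer_H (J k \<omega>) (J k \<omega>)"
  note second = complex_gaussian_second_moment[OF J] and fourth = complex_gaussian_fourth_moment[OF J]
  have "has_bochner_integral M (\<lambda>\<omega>. (\<Sum>k<K. ?A k \<omega> $ i $ j) / of_nat K) ((\<Sum>k<K. S $ i $ j) / of_nat K)"
    by (intro has_bochner_integral_divide_zero has_bochner_integral_sum second) simp
  then show "has_bochner_integral M (\<lambda>\<omega>. sample_cov K J \<omega> $ i $ j) (S $ i $ j)"
    using K by (simp add: sample_cov_nth)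
  \<comment> \<open>Factoring single entries serves both double sums, since a product of traces and
    the trace of a product are each sums of products of two entries.\<close>
  have cross: "has_bochner_integral M (\<lambda>\<omega>. ?A k \<omega> $ a $ b * ?A l \<omega> $ c $ d) (S $ a $ b * S $ c $ d)"
    if "k < K" "l < K" "k \<noteq> l" for k l a b c d
    by (rule has_bochner_integral_mult_indep_vars[OF indep, where f="\<lambda>x. outer_H x x $ a $ b"
          and g="\<lambda>x. outer_H x x $ c $ d"])
      (use that second borel_measurable_outer_H_nth in auto)
  have "has_bochner_integral M (\<lambda>\<omega>. trace (?A k \<omega>) * trace (?A l \<omega>))
      ((trace S)\<^sup>2 + (if k = l then trace (S ** S) else 0))" if "k < K" "l < K" for k l
  proof (cases "k = l")
    case True
    then show ?thesis using fourth that by (simp add: power2_eq_square)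
  next
    case False
    have "has_bochner_integral M (\<lambda>\<omega>. \<Sum>a\<in>UNIV. \<Sum>b\<in>UNIV. ?A k \<omega> $ a $ a * ?A l \<omega> $ b $ b)
        (\<Sum>a\<in>UNIV. \<Sum>b\<in>UNIV. S $ a $ a * S $ b $ b)"
      using False that by (intro has_bochner_integral_sum cross)
    then show ?thesis using False by (simp add: trace_def power2_eq_square sum_product)
  qed
  then have "has_bochner_integral M
      (\<lambda>\<omega>. (\<Sum>k<K. \<Sum>l<K. trace (?A k \<omega>) * trace (?A l \<omega>)) / (of_nat K * of_nat K))
      ((\<Sum>k<K. \<Sum>l<K. (trace S)\<^sup>2 + (if k = l then trace (S ** S) else 0)) / (of_nat K * of_nat K))"
    by (intro has_bochner_integral_divide_zero has_bochner_integral_sum) auto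
  also have "(\<lambda>\<omega>. (\<Sum>k<K. \<Sum>l<K. trace (?A k \<omega>) * trace (?A l \<omega>)) / (of_nat K * of_nat K)) =
      (\<lambda>\<omega>. (trace (sample_cov K J \<omega>))\<^sup>2)"
    by (simp add: trace_sample_cov power2_eq_square sum_product)
  also have "(\<Sum>k<K. \<Sum>l<K. (trace S)\<^sup>2 + (if k = l then trace (S ** S) else 0)) / (of_nat K * of_nat K) =
      (trace S)\<^sup>2 + trace (S ** S) / of_nat K"
    unfolding sum_sum_diagonal using K by (simp add: field_simps)
  finally show "has_bochner_integral M (\<lambda>\<omega>. (trace (sample_cov K J \<omega>))\<^sup>2)
      ((trace S)\<^sup>2 + trace (S ** S) / of_nat K)" .
  \<comment> \<open>On the diagonal, \<open>trace_outer_H_sq\<close> reduces to the squared trace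
    already treated; only the roles of base value and correction are exchanged.\<close>
  have "has_bochner_integral M (\<lambda>\<omega>. trace (?A k \<omega> ** ?A l \<omega>))
      (trace (S ** S) + (if k = l then (trace S)\<^sup>2 else 0))" if "k < K" "l < K" for k l
  proof (cases "k = l")
    case True
    then show ?thesis using fourth that by (simp add: trace_outer_H_sq add.commute)
  next
    case False
    have "has_bochner_integral M (\<lambda>\<omega>. \<Sum>a\<in>UNIV. \<Sum>b\<in>UNIV. ?A k \<omega> $ a $ b * ?A l \<omega> $ b $ a)
        (\<Sum>a\<in>UNIV. \<Sum>b\<in>UNIV. S $ a $ b * S $ b $ a)"
      using False that by (intro has_bochner_integral_sum cross)
    then show ?thesis using False by (simp add: trace_matrix_mult)
  qed
  then have "has_bochner_integral M
      (\<lambda>\<omega>. (\<Sum>k<K. \<Sum>l<K. trace (?A k \<omega> ** ?A l \<omega>)) / (of_nat K * of_nat K))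
      ((\<Sum>k<K. \<Sum>l<K. trace (S ** S) + (if k = l then (trace S)\<^sup>2 else 0)) / (of_nat K * of_nat K))"
    by (intro has_bochner_integral_divide_zero has_bochner_integral_sum) auto
  also have "(\<lambda>\<omega>. (\<Sum>k<K. \<Sum>l<K. trace (?A k \<omega> ** ?A l \<omega>)) / (of_nat K * of_nat K)) =
      (\<lambda>\<omega>. trace (sample_cov K J \<omega> ** sample_cov K J \<omega>))"
  proof
    fix \<omega>
    have "trace (sample_cov K J \<omega> ** sample_cov K J \<omega>) =
        (\<Sum>a\<in>UNIV. \<Sum>b\<in>UNIV. \<Sum>k<K. \<Sum>l<K. ?A k \<omega> $ a $ b * ?A l \<omega> $ b $ a) / (of_nat K * of_nat K)"
      by (simp add: trace_matrix_mult sample_cov_nth sum_product sum_divide_distrib)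
    also have "(\<Sum>a\<in>UNIV. \<Sum>b\<in>UNIV. \<Sum>k<K. \<Sum>l<K. ?A k \<omega> $ a $ b * ?A l \<omega> $ b $ a) =
        (\<Sum>k<K. \<Sum>l<K. trace (?A k \<omega> ** ?A l \<omega>))"
      unfolding trace_matrix_mult by (simp only: sum.swap[of _ "{..<K}" UNIV])
    finally show "(\<Sum>k<K. \<Sum>l<K. trace (?A k \<omega> ** ?A l \<omega>)) / (of_nat K * of_nat K) =
        trace (sample_cov K J \<omega> ** sample_cov K J \<omega>)" ..
  qed
  also have "(\<Sum>k<K. \<Sum>l<K. trace (S ** S) + (if k = l then (trace S)\<^sup>2 else 0)) / (of_nat K * of_nat K) =
      trace (S ** S) + (trace S)\<^sup>2 / of_nat K"
    unfolding sum_sum_diagonal using K by (simp add: field_simps)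
  finally show "has_bochner_integral M (\<lambda>\<omega>. trace (sample_cov K J \<omega> ** sample_cov K J \<omega>))
      (trace (S ** S) + (trace S)\<^sup>2 / of_nat K)" .
qed

end

section \<open>Numerator and denominator of the ratio\<close>

theorem theorem1:
  fixes M :: "'w measure"
    and S :: "complex ^ 'p ^ 'p"
    and K :: nat
    and J :: "nat \<Rightarrow> 'w \<Rightarrow> complex ^ 'p"
  assumes "prob_space M"
    and "K \<ge> 1"
    and "positive_semidefinite S"
    and "prob_space.indep_vars M (\<lambda>_. borel) J {..<K}"
    and "\<And>k. k < K \<Longrightarrow> complex_gaussian M S (J k)"
    and "rho0_den M K J \<noteq> 0"
  shows "rho0 M S K J =
    ((trace S)\<^sup>2 - 1 / of_nat CARD('p) * trace (S ** S)) /
    ((1 - of_nat K / of_nat CARD('p)) * (trace S)\<^sup>2 + (of_nat K - 1 / of_nat CARD('p)) * trace (S ** S))"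
proof -
  interpret prob_space M by fact
  let ?n = "of_nat CARD('p) :: complex" and ?t = "trace S" and ?q = "trace (S ** S)"
  note moments = sample_cov_moments[OF assms(2,4,5)]
  \<comment> \<open>This is the expanded denominator; it also forms the first two terms of the
    numerator.\<close>
  have den_integral: "has_bochner_integral M
      (\<lambda>\<omega>. trace (sample_cov K J \<omega> ** sample_cov K J \<omega>) - (trace (sample_cov K J \<omega>))\<^sup>2 / ?n)
      (?q + ?t\<^sup>2 / of_nat K - (?t\<^sup>2 + ?q / of_nat K) / ?n)"
    by (intro has_bochner_integral_diff has_bochner_integral_divide_zero moments(2,3))
  have "has_bochner_integral M (\<lambda>\<omega>. trace (S ** sample_cov K J \<omega>)) ?q"
    unfolding trace_matrix_mult
    by (intro has_bochner_integral_sum has_bochner_integral_mult_right moments(1))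
  moreover have "has_bochner_integral M (\<lambda>\<omega>. trace (sample_cov K J \<omega>)) ?t"
    unfolding trace_def by (intro has_bochner_integral_sum moments(1))
  ultimately have "has_bochner_integral M
      (\<lambda>\<omega>. trace (sample_cov K J \<omega> ** sample_cov K J \<omega>) - (trace (sample_cov K J \<omega>))\<^sup>2 / ?n
        - trace (S ** sample_cov K J \<omega>) + trace (sample_cov K J \<omega>) / ?n * ?t)
      (?q + ?t\<^sup>2 / of_nat K - (?t\<^sup>2 + ?q / of_nat K) / ?n - ?q + ?t / ?n * ?t)"
    by (intro has_bochner_integral_add has_bochner_integral_diff has_bochner_integral_mult_left
        has_bochner_integral_divide_zero den_integral)
  then have "rho0_num M S K J =
      ?q + ?t\<^sup>2 / of_nat K - (?t\<^sup>2 + ?q / of_nat K) / ?n - ?q + ?t / ?n * ?t"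
    by (simp only: rho0_num_def target_def trace_mult_scaled_target has_bochner_integral_iff)
  \<comment> \<open>The terms without a factor 1/K cancel: \<open>?q\<close> against the mean of
    \<open>trace (S ** sample_cov K J \<omega>)\<close>, and \<open>?t\<^sup>2 / ?n\<close> against
    the last summand.\<close>
  also have "\<dots> = (?t\<^sup>2 - 1 / ?n * ?q) / of_nat K"
    using assms(2) by (simp add: field_simps power2_eq_square)
  finally have num: "rho0_num M S K J = (?t\<^sup>2 - 1 / ?n * ?q) / of_nat K" .
  have "rho0_den M K J = ?q + ?t\<^sup>2 / of_nat K - (?t\<^sup>2 + ?q / of_nat K) / ?n"
    using den_integral
    by (simp only: rho0_den_def target_def trace_mult_scaled_target(2) has_bochner_integral_iff)
  also have "\<dots> = ((1 - of_nat K / ?n) * ?t\<^sup>2 + (of_nat K - 1 / ?n) * ?q) / of_nat K"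
    using assms(2) by (simp add: field_simps)
  \<comment> \<open>Numerator and denominator share the factor 1/K, which cancels because K is
    nonzero.\<close>
  finally show ?thesis
    using assms(2) by (simp add: rho0_def num)
qed

end
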